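(* For every integer $n\ge 5$, $\mathscr{Z}(C_n(2))=P_{n-1}$, where $C_n(2)$ denotes the graph consisting of the cycle with vertices $1,\dots,n$ (in cyclic order) together with the two additional edges $\{1,3\}$ and $\{3,n\}$.
   Context: All graphs are finite, simple and undirected; equality of graphs here means isomorphism. $P_m$ denotes the path on $m$ vertices. Zero forcing: vertices of a graph $G$ are colored blue or white; the color change rule says that a blue vertex $u$ can change the color of a white vertex $w$ to blue if $w$ is the unique white neighbor of $u$. A set $B\subseteq V(G)$ is a zero forcing set of $G$ if, starting with exactly the vertices of $B$ blue and applying the color change rule repeatedly, all vertices eventually become blue. The zero forcing number $\operatorname{Z}(G)$ is the minimum of $|B|$ over all zero forcing sets $B$ of $G$; a minimum zero forcing set is a zero forcing set $B$ with $|B|=\operatorname{Z}(G)$. The zero forcing graph $\mathscr{Z}(G)$ is the graph whose vertices are the minimum zero forcing sets of $G$, with two of them adjacent if and only if their symmetric difference has exactly two elements. *)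

theory Defs
  imports "Graph_Theory.Graph_Theory"
begin

text \<open>
  Finite simple undirected graphs are the instances of the library locale \<^locale>\<open>pair_graph\<close>:
  an undirected edge \<open>{u, v}\<close> is the pair of arcs \<open>(u, v)\<close>, \<open>(v, u)\<close>.  Equality of graphs is
  \<^const>\<open>digraph_iso\<close>; for such graphs this is the usual notion, see \<open>digraph_iso_pair_iff\<close> below.
\<close>

definition graph_of_edges :: "'a set \<Rightarrow> 'a set set \<Rightarrow> 'a pair_pre_digraph" where
  "graph_of_edges V E = \<lparr> pverts = V, parcs = {(u, v). {u, v} \<in> E} \<rparr>"

definition path_graph :: "nat \<Rightarrow> nat pair_pre_digraph" where
  "path_graph m = graph_of_edges {1..m} {{i, i + 1} | i. 1 \<le> i \<and> i < m}"

text \<open>The graph \<open>C\<^sub>n(2)\<close>; it is intended for \<open>n \<ge> 5\<close>.\<close>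

definition cycle_two_chords :: "nat \<Rightarrow> nat pair_pre_digraph" where
  "cycle_two_chords n =
     graph_of_edges {1..n}
       ({{i, i + 1} | i. 1 \<le> i \<and> i < n} \<union> {{n, 1}} \<union> {{1, 3}, {3, n}})"

definition neighbors :: "'a pair_pre_digraph \<Rightarrow> 'a \<Rightarrow> 'a set" where
  "neighbors G u = {v \<in> pverts G. (u, v) \<in> parcs G}"

text \<open>A colouring is represented by its set of blue vertices.\<close>

inductive color_change :: "'a pair_pre_digraph \<Rightarrow> 'a set \<Rightarrow> 'a set \<Rightarrow> bool"
  for G :: "'a pair_pre_digraph" where
  "u \<in> B \<Longrightarrow> neighbors G u - B = {w} \<Longrightarrow> color_change G B (insert w B)"

definition zero_forcing_set :: "'a pair_pre_digraph \<Rightarrow> 'a set \<Rightarrow> bool" where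
  "zero_forcing_set G B \<longleftrightarrow> B \<subseteq> pverts G \<and> (color_change G)\<^sup>*\<^sup>* B (pverts G)"

definition zero_forcing_number :: "'a pair_pre_digraph \<Rightarrow> nat" where
  "zero_forcing_number G = Min (card ` {B. zero_forcing_set G B})"

definition min_zero_forcing_set :: "'a pair_pre_digraph \<Rightarrow> 'a set \<Rightarrow> bool" where
  "min_zero_forcing_set G B \<longleftrightarrow> zero_forcing_set G B \<and> card B = zero_forcing_number G"

definition zero_forcing_graph :: "'a pair_pre_digraph \<Rightarrow> 'a set pair_pre_digraph" where
  "zero_forcing_graph G =
     \<lparr> pverts = {B. min_zero_forcing_set G B},
       parcs = {(A, B). min_zero_forcing_set G A \<and> min_zero_forcing_set G B
                        \<and> card (sym_diff A B) = 2} \<rparr>"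

lemma pair_graph_graph_of_edges:
  assumes "finite V" "\<And>e. e \<in> E \<Longrightarrow> e \<subseteq> V \<and> card e = 2"
  shows "pair_graph (graph_of_edges V E)"
proof -
  have "parcs (graph_of_edges V E) \<subseteq> V \<times> V"
    using assms(2) by (fastforce simp: graph_of_edges_def)
  then have "finite (parcs (graph_of_edges V E))"
    using assms(1) by (meson finite_SigmaI finite_subset)
  moreover have "symmetric (with_proj (graph_of_edges V E))"
    by (auto simp: symmetric_def graph_of_edges_def sym_def insert_commute)
  moreover have "u \<noteq> v" if "{u, v} \<in> E" for u v
    using assms(2)[OF that] by auto
  ultimately show ?thesis
    using assms by unfold_locales (fastforce simp: graph_of_edges_def)+
qed

lemma pair_graph_path_graph: "pair_graph (path_graph m)"
  unfolding path_graph_def by (rule pair_graph_graph_of_edges) auto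

lemma pair_graph_cycle_two_chords: "n \<ge> 5 \<Longrightarrow> pair_graph (cycle_two_chords n)"
  unfolding cycle_two_chords_def by (rule pair_graph_graph_of_edges) auto

lemma pair_graph_zero_forcing_graph:
  assumes "finite (pverts G)"
  shows "pair_graph (zero_forcing_graph G)"
proof -
  have fin: "finite {B. min_zero_forcing_set G B}"
    by (rule finite_subset[of _ "Pow (pverts G)"])
       (use assms in \<open>auto simp: min_zero_forcing_set_def zero_forcing_set_def\<close>)
  have "finite (parcs (zero_forcing_graph G))"
    by (rule finite_subset[OF _ finite_cartesian_product[OF fin fin]])
       (auto simp: zero_forcing_graph_def)
  moreover have "symmetric (with_proj (zero_forcing_graph G))"
    by (auto simp: symmetric_def zero_forcing_graph_def sym_def Un_commute)
  ultimately show ?thesis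
    using fin by unfold_locales (auto simp: zero_forcing_graph_def)
qed

lemma digraph_iso_pair_iff:
  assumes "pair_graph G" "pair_graph H"
  shows "digraph_iso (with_proj G) (with_proj H) \<longleftrightarrow>
    (\<exists>f. bij_betw f (pverts G) (pverts H) \<and>
         (\<forall>u \<in> pverts G. \<forall>v \<in> pverts G. (u, v) \<in> parcs G \<longleftrightarrow> (f u, f v) \<in> parcs H))"
    (is "?L \<longleftrightarrow> ?R")
proof -
  interpret G: pair_graph G by fact
  interpret H: pair_graph H by fact
  show ?thesis
  proof
    assume ?L
    then obtain h where h: "pre_digraph.digraph_isomorphism (with_proj G) h"
      and H: "with_proj H = app_iso h (with_proj G)"
      by (auto simp: digraph_iso_def)
    let ?f = "iso_verts h"
    have inj: "inj_on ?f (pverts G)" and ends: "\<And>a. a \<in> parcs G \<Longrightarrow>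
        ?f (fst a) = iso_tail h (iso_arcs h a) \<and> ?f (snd a) = iso_head h (iso_arcs h a)"
      using h by (auto simp: pre_digraph.digraph_isomorphism_def)
    have eqs: "pverts H = ?f ` pverts G" "parcs H = iso_arcs h ` parcs G"
        "iso_tail h = fst" "iso_head h = snd"
      using H by (auto simp: with_proj_def app_iso_def)
    have arc: "iso_arcs h a = (?f (fst a), ?f (snd a))" if "a \<in> parcs G" for a
      using ends[OF that] eqs by (simp add: prod_eq_iff)
    have "(u, v) \<in> parcs G \<longleftrightarrow> (?f u, ?f v) \<in> parcs H"
      if "u \<in> pverts G" "v \<in> pverts G" for u v
    proof
      assume "(u, v) \<in> parcs G"
      then show "(?f u, ?f v) \<in> parcs H" using arc[of "(u, v)"] eqs by force
    next
      assume "(?f u, ?f v) \<in> parcs H"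
      then obtain a where a: "a \<in> parcs G" "(?f u, ?f v) = iso_arcs h a"
        using eqs by auto
      moreover have "fst a \<in> pverts G" "snd a \<in> pverts G"
        using a(1) G.arc_fst_in_verts G.arc_snd_in_verts by auto
      ultimately have "fst a = u" "snd a = v"
        using arc[OF a(1)] inj that by (auto dest: inj_onD)
      then show "(u, v) \<in> parcs G" using a(1) by auto
    qed
    then show ?R using inj eqs(1) by (intro exI[of _ ?f]) (auto simp: bij_betw_def)
  next
    assume ?R
    then obtain f where f: "bij_betw f (pverts G) (pverts H)"
      and adj: "\<And>u v. u \<in> pverts G \<Longrightarrow> v \<in> pverts G \<Longrightarrow>
        (u, v) \<in> parcs G \<longleftrightarrow> (f u, f v) \<in> parcs H"
      by blast
    define h where "h = \<lparr> iso_verts = f, iso_arcs = map_prod f f, iso_head = snd, iso_tail = fst \<rparr>"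
    have sub: "parcs G \<subseteq> pverts G \<times> pverts G"
      using G.arc_fst_in_verts G.arc_snd_in_verts by force
    have inj: "inj_on f (pverts G)" and img: "f ` pverts G = pverts H"
      using f by (auto simp: bij_betw_def)
    have "inj_on (map_prod f f) (parcs G)"
      using inj_on_subset[OF map_prod_inj_on[OF inj inj] sub] .
    then have "pre_digraph.digraph_isomorphism (with_proj G) h"
      using inj G.wf_digraph by (auto simp: pre_digraph.digraph_isomorphism_def h_def)
    moreover have "map_prod f f ` parcs G = parcs H"
    proof (intro equalityI subsetI)
      fix a assume "a \<in> map_prod f f ` parcs G"
      then show "a \<in> parcs H" using sub adj by fastforce
    next
      fix a assume a: "a \<in> parcs H"
      then have "fst a \<in> f ` pverts G" "snd a \<in> f ` pverts G"
        using H.arc_fst_in_verts H.arc_snd_in_verts img by auto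
      then obtain u v where uv: "u \<in> pverts G" "v \<in> pverts G" "a = (f u, f v)"
        by (metis imageE prod.collapse)
      then have "(u, v) \<in> parcs G" using a adj by simp
      then show "a \<in> map_prod f f ` parcs G" using uv by force
    qed
    then have "with_proj H = app_iso h (with_proj G)"
      using img by (simp add: with_proj_def app_iso_def h_def)
    ultimately show ?L by (auto simp: digraph_iso_def)
  qed
qed

end

theory Submission
  imports Defs
begin

text \<open>
  A first force from a set of at most two vertices must come from a blue vertex of degree two that
  has a blue neighbour.  In \<open>C\<^sub>n(2)\<close> the vertices of degree two are \<open>2\<close> and \<open>4, \<dots>, n - 1\<close>, so such
  a set is \<open>{i, i + 1}\<close> for some \<open>1 \<le> i < n\<close>; conversely each of these pairs forces
  everything.  Two distinct pairs have a symmetric difference of size two exactly when they overlap,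
  so the smaller element of the pair is an isomorphism onto the path.
\<close>

lemma mem_neighbors_graph_of_edges: "v \<in> neighbors (graph_of_edges V E) u \<longleftrightarrow> v \<in> V \<and> {u, v} \<in> E"
  by (simp add: neighbors_def graph_of_edges_def)

lemma doubleton_mem_consecutive:
  "{u, v} \<in> {{i, i + 1} | i::nat. 1 \<le> i \<and> i < n} \<longleftrightarrow>
     1 \<le> u \<and> u < n \<and> v = u + 1 \<or> 1 \<le> v \<and> v < n \<and> u = v + 1"
  by (auto simp: doubleton_eq_iff)

lemma mem_neighbors_cycle_two_chords:
  "v \<in> neighbors (cycle_two_chords n) u \<longleftrightarrow> 1 \<le> v \<and> v \<le> n \<and>
     (1 \<le> u \<and> u < n \<and> v = u + 1 \<or> 1 \<le> v \<and> v < n \<and> u = v + 1 \<or>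
      u = n \<and> v = 1 \<or> u = 1 \<and> v = n \<or> u = 1 \<and> v = 3 \<or> u = 3 \<and> v = 1 \<or>
      u = 3 \<and> v = n \<or> u = n \<and> v = 3)"
  unfolding cycle_two_chords_def mem_neighbors_graph_of_edges Un_iff doubleton_mem_consecutive
  by (simp add: doubleton_eq_iff)

lemma neighbors_cycle_two_chords:
  assumes "n \<ge> 5"
  shows "neighbors (cycle_two_chords n) 1 = {2, 3, n}"
    and "neighbors (cycle_two_chords n) 2 = {1, 3}"
    and "neighbors (cycle_two_chords n) 3 = {1, 2, 4, n}"
    and "neighbors (cycle_two_chords n) n = {1, 3, n - 1}"
    and "4 \<le> k \<Longrightarrow> k < n \<Longrightarrow> neighbors (cycle_two_chords n) k = {k - 1, k + 1}"
  by (rule set_eqI, use assms in \<open>simp add: mem_neighbors_cycle_two_chords, linarith\<close>)+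

lemma pverts_cycle_two_chords [simp]: "pverts (cycle_two_chords n) = {1..n}"
  by (simp add: cycle_two_chords_def graph_of_edges_def)

text \<open>The separate equation for \<open>C\<close> lets the result of a force be given in any
  convenient form, such as an interval, instead of literally as \<open>insert w B\<close>.\<close>

lemma color_changeI:
  assumes "u \<in> B" "neighbors G u - B = {w}" "C = insert w B"
  shows "color_change G B C"
  using assms color_change.intros by metis

text \<open>Since \<open>a < b\<close>, the top vertex \<open>b\<close> is at least 4 and its
  neighbor \<open>b - 1\<close> is blue. While \<open>b < n\<close> it has degree two, so it forces
  \<open>b + 1\<close>.\<close>

lemma color_change_upwards:
  assumes "n \<ge> 5" "3 \<le> a" "a < b" "b \<le> n"
  shows "(color_change (cycle_two_chords n))\<^sup>*\<^sup>* {a..b} {a..n}"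
  using assms(4,3)
proof (induction b rule: inc_induct)
  case (step b)
  have "color_change (cycle_two_chords n) {a..b} {a..Suc b}"
    by (rule color_changeI[of b _ _ "Suc b"])
       (use step assms in \<open>auto simp: neighbors_cycle_two_chords(5)\<close>)
  with step show ?case
    by (simp add: converse_rtranclp_into_rtranclp)
qed simp

text \<open>The mirror image: as long as \<open>Suc a < n\<close>, the bottom vertex
  \<open>Suc a\<close> has degree two and a blue upper neighbor, so it forces \<open>a\<close>. The
  descent ends at 3, which has degree four.\<close>

lemma color_change_downwards:
  assumes "n \<ge> 5" "3 \<le> a" "a < n"
  shows "(color_change (cycle_two_chords n))\<^sup>*\<^sup>* {a..n} {3..n}"
  using assms(2,3)
proof (induction a rule: dec_induct)
  case (step a)
  have "color_change (cycle_two_chords n) {Suc a..n} {a..n}"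
    by (rule color_changeI[of "Suc a" _ _ a])
       (use step assms in \<open>auto simp: neighbors_cycle_two_chords(5)\<close>)
  with step show ?case
    by (simp add: converse_rtranclp_into_rtranclp)
qed simp

text \<open>With \<open>n\<close> blue, the vertex 3 has 4 as its only possible white neighbor, so
  the sweep can pass 3. It then runs through vertices of degree two until it meets
  \<open>n\<close>.\<close>

lemma color_change_around:
  assumes "n \<ge> 5" "3 \<le> k" "k \<le> n - 1"
  shows "(color_change (cycle_two_chords n))\<^sup>*\<^sup>* (insert n {1..k}) {1..n}"
  using assms(3,2)
proof (induction k rule: inc_induct)
  case base
  have "insert n {1..n - 1} = {1..n}"
    using assms by auto
  then show ?case by simp
next
  case (step k)
  have "color_change (cycle_two_chords n) (insert n {1..k}) (insert n {1..Suc k})"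
  proof (rule color_changeI[of k _ _ "Suc k"])
    show "neighbors (cycle_two_chords n) k - insert n {1..k} = {Suc k}"
      using step assms by (cases "k = 3") (auto simp: neighbors_cycle_two_chords)
  qed (use step in auto)
  with step show ?case
    by (simp add: converse_rtranclp_into_rtranclp)
qed

lemma zero_forcing_set_consecutive:
  assumes "n \<ge> 5" "1 \<le> i" "i < n"
  shows "zero_forcing_set (cycle_two_chords n) {i, i + 1}"
proof -
  let ?step = "color_change (cycle_two_chords n)"
  note nbrs = neighbors_cycle_two_chords[OF assms(1)]
  have from_triangle: "?step\<^sup>*\<^sup>* {1, 2, 3} {1..n}"
  proof -
    have "?step {1, 2, 3} (insert n {1..3})"
      by (rule color_changeI[of 1 _ _ n]) (use assms(1) nbrs in auto)
    then show ?thesis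
      using color_change_around[of n 3] assms(1) by (simp add: converse_rtranclp_into_rtranclp)
  qed
  consider "i = 1" | "i = 2" | "3 \<le> i"
    using assms(2) by linarith
  then have "?step\<^sup>*\<^sup>* {i, i + 1} {1..n}"
  proof cases
    case 1
    have "?step {i, i + 1} {1, 2, 3}"
      by (rule color_changeI[of 2 _ _ 3]) (use 1 nbrs in auto)
    then show ?thesis
      using from_triangle by (rule converse_rtranclp_into_rtranclp)
  next
    case 2
    have "?step {i, i + 1} {1, 2, 3}"
      by (rule color_changeI[of 2 _ _ 1]) (use 2 nbrs in auto)
    then show ?thesis
      using from_triangle by (rule converse_rtranclp_into_rtranclp)
  next
    case 3
    have "{i, i + 1} = {i..i + 1}"
      by auto
    then have "?step\<^sup>*\<^sup>* {i, i + 1} {3..n}"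
      using color_change_upwards[of n i "i + 1"] color_change_downwards[of n i] assms 3 by simp
    \<comment> \<open>Now 3 has the two white neighbors 1 and 2 and cannot force; \<open>n\<close>
      is adjacent to 1 but not to 2.\<close>
    also have "?step {3..n} (insert 1 {3..n})"
      by (rule color_changeI[of n _ _ 1]) (use assms(1) nbrs in auto)
    also have "?step (insert 1 {3..n}) {1..n}"
      by (rule color_changeI[of 1 _ _ 2]) (use assms(1) nbrs in auto)
    finally show ?thesis .
  qed
  then show ?thesis
    using assms by (simp add: zero_forcing_set_def)
qed

lemma color_change_card_le_2:
  assumes "n \<ge> 5" "color_change (cycle_two_chords n) B C" "B \<subseteq> {1..n}" "card B \<le> 2"
  obtains i where "1 \<le> i" "i < n" "B = {i, i + 1}"
proof -
  note nbrs = neighbors_cycle_two_chords[OF assms(1)]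
  obtain u w where u: "u \<in> B" and w: "neighbors (cycle_two_chords n) u - B = {w}"
    using assms(2) by (auto elim: color_change.cases)
  have "card (B - {u}) \<le> 1" "finite B"
    using assms(3,4) u finite_subset by (auto simp: card_Diff_singleton)
  \<comment> \<open>\<open>b\<close> is the only possible second blue vertex; nothing is claimed
    about it when \<open>B = {u}\<close>.\<close>
  then obtain b where b: "B \<subseteq> {u, b}"
    by (metis Diff_subset_conv card_le_Suc0_iff_eq One_nat_def finite_Diff insertCI
        insert_is_Un singletonD subsetI)
  with w have nb: "neighbors (cycle_two_chords n) u \<subseteq> {u, b, w}"
    by auto
  \<comment> \<open>Each of these vertices has at least three neighbors, all different from itself,
    which do not fit into \<open>{b, w}\<close>.\<close>
  have "u \<noteq> 1" "u \<noteq> 3" "u \<noteq> n"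
    using nb nbrs assms(1) by auto
  then consider "u = 2" | "4 \<le> u" "u < n"
    using assms(3) u by force
  \<comment> \<open>Only one of the two neighbors is white, so the other is blue and must be the
    second element of \<open>B\<close>.\<close>
  moreover have pair: "B = {u, x} \<or> B = {u, y}"
    if xy: "neighbors (cycle_two_chords n) u = {x, y}" "x \<noteq> u" "y \<noteq> u" "x \<noteq> y" for x y
  proof -
    have "x \<in> B \<or> y \<in> B"
      using w xy(1,4) by (metis insertI1 insertI2 DiffI singletonD)
    then show ?thesis
      using b u xy(2,3) by blast
  qed
  ultimately show thesis
  proof cases
    case 1
    then have "B = {2, 1} \<or> B = {2, 3}"
      using pair[of 1 3] nbrs(2) by simp
    then show thesis
      using that[of 1] that[of 2] assms(1) by (auto simp: insert_commute numeral_eq_Suc)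
  next
    case 2
    then have "B = {u, u - 1} \<or> B = {u, u + 1}"
      using pair[of "u - 1" "u + 1"] nbrs(5) by simp
    then show thesis
      using that[of "u - 1"] that[of u] 2 by (auto simp: insert_commute)
  qed
qed

text \<open>Allowing all sizes up to two serves both purposes: it rules out zero forcing sets with
  fewer than two elements and classifies those with exactly two.\<close>

lemma zero_forcing_set_card_le_2:
  assumes "n \<ge> 5" "zero_forcing_set (cycle_two_chords n) B" "card B \<le> 2"
  obtains i where "1 \<le> i" "i < n" "B = {i, i + 1}"
proof -
  \<comment> \<open>This excludes the run without any force, so that there is a first force to
    inspect.\<close>
  have "B \<noteq> {1..n}"
    using assms by auto
  then obtain C where "color_change (cycle_two_chords n) B C"
    using assms(2) by (auto simp: zero_forcing_set_def elim: converse_rtranclpE)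
  then show thesis
    using color_change_card_le_2 that assms by (auto simp: zero_forcing_set_def)
qed

lemma zero_forcing_number_cycle_two_chords:
  assumes "n \<ge> 5"
  shows "zero_forcing_number (cycle_two_chords n) = 2"
  unfolding zero_forcing_number_def
proof (rule Min_eqI)
  have "{B. zero_forcing_set (cycle_two_chords n) B} \<subseteq> Pow {1..n}"
    by (auto simp: zero_forcing_set_def)
  then show "finite (card ` {B. zero_forcing_set (cycle_two_chords n) B})"
    using finite_subset by blast
next
  fix c
  assume "c \<in> card ` {B. zero_forcing_set (cycle_two_chords n) B}"
  then obtain B where B: "zero_forcing_set (cycle_two_chords n) B" "c = card B"
    by auto
  show "2 \<le> c"
  proof (rule ccontr)
    assume "\<not> 2 \<le> c"
    moreover from this obtain i where "B = {i, i + 1}"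
      using zero_forcing_set_card_le_2[OF assms B(1)] B(2) by auto
    ultimately show False
      using B(2) by simp
  qed
next
  have "zero_forcing_set (cycle_two_chords n) {1, 1 + 1}"
    using assms by (intro zero_forcing_set_consecutive) auto
  then show "2 \<in> card ` {B. zero_forcing_set (cycle_two_chords n) B}"
    by force
qed

lemma min_zero_forcing_set_cycle_two_chords:
  assumes "n \<ge> 5"
  shows "min_zero_forcing_set (cycle_two_chords n) B \<longleftrightarrow> (\<exists>i. 1 \<le> i \<and> i < n \<and> B = {i, i + 1})"
proof
  assume "min_zero_forcing_set (cycle_two_chords n) B"
  then have "zero_forcing_set (cycle_two_chords n) B" "card B \<le> 2"
    by (simp_all add: min_zero_forcing_set_def zero_forcing_number_cycle_two_chords[OF assms])
  then show "\<exists>i. 1 \<le> i \<and> i < n \<and> B = {i, i + 1}"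
    using zero_forcing_set_card_le_2[OF assms] by metis
next
  assume "\<exists>i. 1 \<le> i \<and> i < n \<and> B = {i, i + 1}"
  then show "min_zero_forcing_set (cycle_two_chords n) B"
    using zero_forcing_set_consecutive[OF assms]
    by (auto simp: min_zero_forcing_set_def zero_forcing_number_cycle_two_chords[OF assms])
qed

text \<open>The size is 0 for equal pairs, 2 for pairs sharing one element and 4 for disjoint
  pairs.\<close>

lemma card_sym_diff_consecutive:
  fixes i j :: nat
  shows "card (sym_diff {i, i + 1} {j, j + 1}) = 2 \<longleftrightarrow> j = i + 1 \<or> i = j + 1"
proof -
  consider "i = j" | "j = i + 1" | "i = j + 1" | "i \<noteq> j" "j \<noteq> i + 1" "i \<noteq> j + 1"
    by blast
  then show ?thesis
  proof cases
    case 4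
    then have "sym_diff {i, i + 1} {j, j + 1} = {i, i + 1, j, j + 1}"
      by auto
    then show ?thesis
      using 4 by simp
  qed (simp_all add: insert_Diff_if)
qed

theorem proposition4p5:
  fixes n :: nat
  assumes "n \<ge> 5"
  shows "digraph_iso (with_proj (zero_forcing_graph (cycle_two_chords n)))
                     (with_proj (path_graph (n - 1)))"
proof -
  let ?Z = "zero_forcing_graph (cycle_two_chords n)" and ?pair = "\<lambda>i::nat. {i, i + 1}"
  have Min_pair: "Min (?pair i) = i" for i
    by simp
  have verts: "pverts ?Z = ?pair ` {1..n - 1}"
    using assms by (force simp: zero_forcing_graph_def min_zero_forcing_set_cycle_two_chords)
  \<comment> \<open>\<open>Min\<close> inverts \<open>?pair\<close>, and the smaller elements of the
    pairs range over \<open>{1..n - 1}\<close>, which is the vertex set of the path.\<close>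
  have "bij_betw Min (pverts ?Z) (pverts (path_graph (n - 1)))"
    unfolding verts
    by (rule bij_betwI[where g = ?pair]) (auto simp: path_graph_def graph_of_edges_def)
  moreover have "(A, B) \<in> parcs ?Z \<longleftrightarrow> (Min A, Min B) \<in> parcs (path_graph (n - 1))"
    if AB: "A \<in> pverts ?Z" "B \<in> pverts ?Z" for A B
  proof -
    obtain i j where ij: "A = ?pair i" "B = ?pair j" "i \<in> {1..n - 1}" "j \<in> {1..n - 1}"
      using AB unfolding verts by auto
    have "(A, B) \<in> parcs ?Z \<longleftrightarrow> card (sym_diff A B) = 2"
      using AB by (simp add: zero_forcing_graph_def)
    also have "\<dots> \<longleftrightarrow> j = i + 1 \<or> i = j + 1"
      unfolding ij by (rule card_sym_diff_consecutive)
    also have "\<dots> \<longleftrightarrow> (i, j) \<in> parcs (path_graph (n - 1))"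
      using ij(3,4) by (auto simp: path_graph_def graph_of_edges_def doubleton_eq_iff)
    finally show ?thesis
      unfolding ij Min_pair .
  qed
  ultimately show ?thesis
    by (subst digraph_iso_pair_iff)
       (auto intro: pair_graph_zero_forcing_graph pair_graph_path_graph)
qed

end
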